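(* Let $G$ be a graph and let $t$ be a positive integer. If $G$ is strongly $t$-degenerate, then $\operatorname{diam}(\mathcal{I}(G)) \leq t$.
   Context: Graphs are finite and simple. In an orientation $\vec{G}$ of a graph $G$, the inversion of a set $X \subseteq V(G)$ consists in reversing all arcs with both endvertices in $X$. The inversion graph $\mathcal{I}(G)$ is the graph whose vertices are the labelled orientations of $G$, two orientations being adjacent if and only if the inversion of some $X\subseteq V(G)$ transforms one into the other; $\operatorname{diam}(\mathcal{I}(G))$ is its diameter. Let $<$ be a total ordering on $V(G)$, and let $N(u)$ denote the set of neighbours of $u$ in $G$. For vertices $u,u'$, let $N_{<u'}(u) = \{v \in N(u) \mid v<u'\}$ and $N_{>u'}(u) = \{v \in N(u) \mid v>u'\}$; write $N_<(u) = N_{<u}(u)$ and $N_>(u) = N_{>u}(u)$. The logarithm $\log$ is in base $2$. The ordering $<$ is $t$-strong if for every $u \in V(G)$: \begin{itemize} \item if $N_>(u) \neq \emptyset$, then $|N_<(u)| + \log\left(|\{X \subseteq V(G) \mid \exists v \in N_>(u),\ X \subseteq N_{<u}(v)\}|\right) < t$, and \item if $N_>(u) = \emptyset$, then $|N_<(u)| \leq t$. \end{itemize} The graph $G$ is strongly $t$-degenerate if there is a $t$-strong ordering of its vertices. *)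

theory Defs
  imports "Graph_Theory.Pair_Digraph" "Graph_Theory.Shortest_Path"
begin

text \<open>
  A finite simple graph is a \<open>pair_graph\<close>: a finite loopfree digraph in which the
  edge \<open>uv\<close> is represented by the two arcs \<open>(u, v)\<close> and \<open>(v, u)\<close>.
\<close>

text \<open>A labelled orientation of \<open>G\<close> is represented by its set of arcs.\<close>

definition orientation :: "'a pair_pre_digraph \<Rightarrow> 'a rel \<Rightarrow> bool" where
  "orientation G A \<longleftrightarrow>
     A \<subseteq> parcs G \<and> (\<forall>(u, v) \<in> parcs G. (u, v) \<in> A \<longleftrightarrow> (v, u) \<notin> A)"

definition inversion :: "'a set \<Rightarrow> 'a rel \<Rightarrow> 'a rel" where
  "inversion X A = (A - X \<times> X) \<union> (A \<inter> X \<times> X)\<inverse>"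

text \<open>
  Inverting the empty set fixes every orientation; \<open>A \<noteq> B\<close> excludes the resulting loops.
\<close>

definition inversion_graph :: "'a pair_pre_digraph \<Rightarrow> 'a rel pair_pre_digraph" where
  "inversion_graph G =
     \<lparr> pverts = {A. orientation G A},
       parcs = {(A, B). orientation G A \<and> orientation G B \<and> A \<noteq> B \<and>
                  (\<exists>X \<subseteq> pverts G. B = inversion X A)} \<rparr>"

text \<open>
  With unit weights, \<open>\<mu>\<close> is the usual graph distance; it is infinite between vertices
  in different components.
\<close>

definition diameter :: "('a, 'b) pre_digraph \<Rightarrow> ereal" where
  "diameter H = (SUP u \<in> verts H. SUP v \<in> verts H. wf_digraph.\<mu> H (\<lambda>_. 1) u v)"

definition nbrs :: "'a pair_pre_digraph \<Rightarrow> 'a \<Rightarrow> 'a set" where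
  "nbrs G u = {v. (u, v) \<in> parcs G}"

text \<open>
  Below, \<open>r\<close> is the strict ordering, \<open>(v, w) \<in> r\<close> meaning \<open>v < w\<close>; \<open>nbrs_less G r w u\<close> is
  \<open>N\<^bsub><w\<^esub>(u)\<close> and \<open>nbrs_greater G r w u\<close> is \<open>N\<^bsub>>w\<^esub>(u)\<close>.
\<close>

definition nbrs_less :: "'a pair_pre_digraph \<Rightarrow> 'a rel \<Rightarrow> 'a \<Rightarrow> 'a \<Rightarrow> 'a set" where
  "nbrs_less G r w u = {v \<in> nbrs G u. (v, w) \<in> r}"

definition nbrs_greater :: "'a pair_pre_digraph \<Rightarrow> 'a rel \<Rightarrow> 'a \<Rightarrow> 'a \<Rightarrow> 'a set" where
  "nbrs_greater G r w u = {v \<in> nbrs G u. (w, v) \<in> r}"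

definition strong_ordering :: "nat \<Rightarrow> 'a pair_pre_digraph \<Rightarrow> 'a rel \<Rightarrow> bool" where
  "strong_ordering t G r \<longleftrightarrow>
     r \<subseteq> pverts G \<times> pverts G \<and> strict_linear_order_on (pverts G) r \<and>
     (\<forall>u \<in> pverts G.
        (nbrs_greater G r u u \<noteq> {} \<longrightarrow>
           real (card (nbrs_less G r u u)) +
           log 2 (real (card {X. X \<subseteq> pverts G \<and>
             (\<exists>v \<in> nbrs_greater G r u u. X \<subseteq> nbrs_less G r u v)})) < real t) \<and>
        (nbrs_greater G r u u = {} \<longrightarrow> card (nbrs_less G r u u) \<le> t))"

definition strongly_degenerate :: "nat \<Rightarrow> 'a pair_pre_digraph \<Rightarrow> bool" where
  "strongly_degenerate t G \<longleftrightarrow> (\<exists>r. strong_ordering t G r)"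

text \<open>
  The constant \<open>wf_digraph.\<mu>\<close> is only meaningful on well-formed digraphs; the inversion graph
  is one, and is itself a finite simple graph.
\<close>

lemma inversion_inversion:
  assumes "A \<inter> A\<inverse> = {}"
  shows "inversion X (inversion X A) = A"
  using assms unfolding inversion_def by auto

lemma orientation_disjoint: "orientation G A \<Longrightarrow> A \<inter> A\<inverse> = {}"
  unfolding orientation_def by fast

lemma orientation_inversion:
  assumes "pair_graph G" "orientation G A"
  shows "orientation G (inversion X A)"
proof -
  interpret pair_graph G by fact
  have "sym (parcs G)"
    using pair_sym_arcs by (simp add: symmetric_def)
  then have s: "(v, u) \<in> parcs G" if "(u, v) \<in> parcs G" for u v
    using that by (auto dest: symD)
  show ?thesis
    using assms(2) s unfolding orientation_def inversion_def by (auto; blast)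
qed

lemma pair_graph_inversion_graph:
  assumes "pair_graph G"
  shows "pair_graph (inversion_graph G)"
proof -
  interpret pair_graph G by fact
  let ?I = "inversion_graph G"
  have verts: "finite (pverts ?I)"
    by (rule finite_subset[of _ "Pow (parcs G)"])
      (auto simp: inversion_graph_def orientation_def pair_finite_arcs)
  have sub: "parcs ?I \<subseteq> pverts ?I \<times> pverts ?I"
    by (auto simp: inversion_graph_def)
  have "sym (parcs ?I)"
  proof (rule symI)
    fix A B assume "(A, B) \<in> parcs ?I"
    then obtain X where "orientation G A" "orientation G B" "A \<noteq> B" "X \<subseteq> pverts G"
      "B = inversion X A"
      by (auto simp: inversion_graph_def)
    note X = this
    have "A = inversion X B"
      using inversion_inversion[OF orientation_disjoint[OF X(1)], of X] X(5) by simp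
    then have "\<exists>X \<subseteq> pverts G. A = inversion X B"
      using X(4) by blast
    then show "(B, A) \<in> parcs ?I"
      using X(1-3) unfolding inversion_graph_def by simp
  qed
  then have sy: "symmetric (with_proj ?I)"
    by (simp add: symmetric_def)
  show ?thesis
  proof unfold_locales
    show "finite (parcs ?I)"
      by (rule finite_subset[OF sub]) (simp add: verts)
    show "fst e \<noteq> snd e" if "e \<in> parcs ?I" for e
      using that by (auto simp: inversion_graph_def)
  qed (use sub verts sy in auto)
qed

end

theory Submission
  imports Defs
begin

text \<open>
  A subset of \<open>{..<t}\<close> stands for a vector of \<open>F\<^sub>2\<^sup>t\<close>: \<open>xor_sum\<close> is addition, and the parity of
  \<open>card (y \<inter> z)\<close> is the scalar product. Inverting the sets \<open>{v. i \<in> x v}\<close> for \<open>i < t\<close> reverses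
  exactly the edges \<open>uv\<close> with odd \<open>card (x u \<inter> x v)\<close>, so it suffices to realise any prescribed
  set of edges by such an \<open>x\<close>. The vectors are chosen in increasing order of the vertices, with
  the invariant that those already given to neighbours of an untreated vertex are independent.
  At \<open>u\<close>, the prescription leaves \<open>2 ^ (t - \<bar>N\<^sub><(u)\<bar>)\<close> vectors, and the invariant survives if the
  new vector avoids the spans of the vectors on \<open>N\<^bsub><u\<^esub>(v)\<close> for \<open>v \<in> N\<^sub>>(u)\<close>. These spans are covered by
  the sums over the sets counted in the logarithm, so a strong ordering leaves room.
\<close>

section \<open>Linear algebra over F_2 with sets as vectors\<close>

definition xor_sum :: "('a \<Rightarrow> 'b set) \<Rightarrow> 'a set \<Rightarrow> 'b set" where
  "xor_sum x S = {i. odd (card {w \<in> S. i \<in> x w})}"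

text \<open>For finite \<open>N\<close> this is linear independence over F_2 of the family
  \<open>x\<close> on \<open>N\<close>, since a choice of coefficients is a choice of a subset.
  Equal vectors at two indices count as dependent.\<close>

definition xor_indep :: "('a \<Rightarrow> 'b set) \<Rightarrow> 'a set \<Rightarrow> bool" where
  "xor_indep x N \<longleftrightarrow> (\<forall>S \<subseteq> N. S \<noteq> {} \<longrightarrow> xor_sum x S \<noteq> {})"

lemma xor_sum_cong: "(\<And>w. w \<in> S \<Longrightarrow> x w = x' w) \<Longrightarrow> xor_sum x S = xor_sum x' S"
proof -
  assume "\<And>w. w \<in> S \<Longrightarrow> x w = x' w"
  then have "{w \<in> S. i \<in> x w} = {w \<in> S. i \<in> x' w}" for i
    by auto
  then show ?thesis by (simp add: xor_sum_def)
qed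

text \<open>Adding \<open>x u\<close> toggles exactly the coordinates in \<open>x u\<close>; this
  isolates a new vector within a sum.\<close>

lemma xor_sum_remove:
  assumes "finite S" "u \<in> S"
  shows "i \<in> xor_sum x S \<longleftrightarrow> (i \<in> x u \<longleftrightarrow> i \<notin> xor_sum x (S - {u}))"
proof -
  have "{w \<in> S. i \<in> x w} =
      (if i \<in> x u then insert u {w \<in> S - {u}. i \<in> x w} else {w \<in> S - {u}. i \<in> x w})"
    using assms by auto
  then show ?thesis
    using assms by (simp add: xor_sum_def)
qed

section \<open>Counting the solutions of linear systems by character sums\<close>

lemma prod_minus_one_if:
  "finite S \<Longrightarrow> (\<Prod>w\<in>S. if P w then - 1 else 1 :: int) = (- 1) ^ card {w \<in> S. P w}"
  by (simp add: prod.If_cases Int_def)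

text \<open>As a function of \<open>y\<close>, the product is the character given by the scalar
  product with \<open>xor_sum x S\<close>. It is nontrivial on the subsets of \<open>I\<close>, so
  its values cancel.\<close>

lemma sum_characters:
  fixes x :: "'a \<Rightarrow> 'b set"
  assumes "finite I" "finite S" "xor_sum x S \<inter> I \<noteq> {}"
  shows "(\<Sum>y \<in> Pow I. \<Prod>w\<in>S. (- 1 :: int) ^ card (y \<inter> x w)) = 0"
proof -
  let ?c = "\<lambda>i. \<Prod>w\<in>S. if i \<in> x w then - 1 else 1 :: int"
  obtain i where i: "i \<in> xor_sum x S" "i \<in> I"
    using assms(3) by auto
  have c: "?c i = - 1"
    using i assms(2) by (simp only: prod_minus_one_if) (simp add: xor_sum_def)
  \<comment> \<open>The factor of ones gives the summand the shape in which \<open>prod_add\<close>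
    expands a product over \<open>I\<close>. The sum then factors over the coordinates, and the
    coordinate \<open>i\<close> contributes 0.\<close>
  have "(\<Prod>w\<in>S. (- 1 :: int) ^ card (y \<inter> x w)) = (\<Prod>i\<in>y. ?c i) * (\<Prod>i\<in>I - y. 1)"
    if "y \<in> Pow I" for y
  proof -
    have "finite y"
      using that assms(1) by (auto intro: finite_subset)
    then have "(- 1 :: int) ^ card (y \<inter> x w) = (\<Prod>i\<in>y. if i \<in> x w then - 1 else 1)" for w
      by (simp only: prod_minus_one_if) (simp add: Int_def)
    then show ?thesis
      by (simp add: prod.swap[of _ S])
  qed
  then have "(\<Sum>y \<in> Pow I. \<Prod>w\<in>S. (- 1 :: int) ^ card (y \<inter> x w)) = (\<Prod>i\<in>I. ?c i + 1)"
    by (simp only: prod_add[OF assms(1)] cong: sum.cong)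
  also have "\<dots> = 0"
    using assms(1) i(2) c by (intro prod_zero bexI[of _ i]) simp_all
  finally show ?thesis .
qed

text \<open>Each of the \<open>card N\<close> independent equations halves the set of candidates.
  The product form avoids the subtraction \<open>card I - card N\<close> and shows at once that a
  solution exists.\<close>

lemma card_xor_solutions:
  assumes "finite I" "finite N" "\<And>w. w \<in> N \<Longrightarrow> x w \<subseteq> I" "xor_indep x N"
  shows "2 ^ card N * card {y. y \<subseteq> I \<and> (\<forall>w\<in>N. odd (card (y \<inter> x w)) \<longleftrightarrow> P w)} = (2 :: nat) ^ card I"
proof -
  \<comment> \<open>\<open>?s w\<close> is the sign prescribed by \<open>P w\<close>, so
    \<open>?e y w\<close> is 1 if \<open>y\<close> satisfies the equation of \<open>w\<close> and -1
    otherwise. The product of the terms \<open>?e y w + 1\<close> is thus a multiple of the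
    indicator of the solutions.\<close>
  let ?s = "\<lambda>w. if P w then - 1 else 1 :: int"
  let ?e = "\<lambda>y w. ?s w * (- 1) ^ card (y \<inter> x w)"
  let ?good = "\<lambda>y. \<forall>w\<in>N. odd (card (y \<inter> x w)) \<longleftrightarrow> P w"
  have e: "?e y w + 1 = (if odd (card (y \<inter> x w)) \<longleftrightarrow> P w then 2 else 0)" for y w
    by (cases "P w"; cases "odd (card (y \<inter> x w))") simp_all
  have good: "(\<Prod>w\<in>N. ?e y w + 1) = (if ?good y then 2 ^ card N else 0)" for y
  proof (cases "?good y")
    case True
    then have "(\<Prod>w\<in>N. ?e y w + 1) = (\<Prod>w\<in>N. 2)"
      unfolding e by (intro prod.cong refl if_P) blast
    then show ?thesis
      unfolding if_P[OF True] prod_constant .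
  next
    case False
    then obtain w where "w \<in> N" "(odd (card (y \<inter> x w)) \<longleftrightarrow> P w) = False" by blast
    then have "(\<Prod>w\<in>N. ?e y w + 1) = 0"
      unfolding e using assms(2) by (intro prod_zero bexI[of _ w]) (simp_all only: if_False)
    then show ?thesis
      unfolding if_not_P[OF False] .
  qed
  \<comment> \<open>the expansion of the indicator of the solutions into characters: only \<open>S = {}\<close> contributes\<close>
  have char: "(\<Sum>y \<in> Pow I. \<Prod>w\<in>S. (- 1 :: int) ^ card (y \<inter> x w)) = (if S = {} then 2 ^ card I else 0)"
    if "S \<in> Pow N" for S
  proof (cases "S = {}")
    case True
    then show ?thesis using assms(1) by (simp add: card_Pow)
  next
    case False
    then obtain i where i: "i \<in> xor_sum x S"
      using assms(4) \<open>S \<in> Pow N\<close> unfolding xor_indep_def by blast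
    then have "{w \<in> S. i \<in> x w} \<noteq> {}"
      unfolding xor_sum_def by (metis (mono_tags, lifting) card.empty even_zero mem_Collect_eq)
    then have "i \<in> I"
      using assms(3) \<open>S \<in> Pow N\<close> by auto
    then have "xor_sum x S \<inter> I \<noteq> {}" using i by auto
    moreover have "finite S"
      using that assms(2) by (auto intro: finite_subset)
    ultimately show ?thesis
      using sum_characters[OF assms(1)] False by simp
  qed
  have "int (2 ^ card N * card {y. y \<subseteq> I \<and> ?good y}) = (\<Sum>y \<in> {y \<in> Pow I. ?good y}. 2 ^ card N)"
    by (simp add: mult.commute)
  also have "\<dots> = (\<Sum>y \<in> Pow I. \<Prod>w\<in>N. ?e y w + 1)"
    unfolding good using assms(1) by (intro sum.inter_filter) auto
  also have "\<dots> = (\<Sum>y \<in> Pow I. \<Sum>S \<in> Pow N. \<Prod>w\<in>S. ?e y w)"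
    using assms(2) by (simp add: prod_add)
  also have "\<dots> = (\<Sum>S \<in> Pow N. (\<Prod>w\<in>S. ?s w) * (\<Sum>y \<in> Pow I. \<Prod>w\<in>S. (- 1) ^ card (y \<inter> x w)))"
    unfolding prod.distrib sum_distrib_left by (rule sum.swap)
  also have "\<dots> = (\<Sum>S \<in> Pow N. if S = {} then 2 ^ card I else 0)"
    using char by (intro sum.cong) auto
  also have "\<dots> = int (2 ^ card I)"
    using assms(2) by (simp add: sum.delta)
  finally show ?thesis by linarith
qed

section \<open>Choosing the vectors along a strong ordering\<close>

lemma finite_strict_order_maximal:
  assumes "finite D" "D \<noteq> {}" "trans r" "irrefl r"
  shows "\<exists>u\<in>D. \<forall>v\<in>D. (u, v) \<notin> r"
  using assms(1,2)
proof (induction rule: finite_ne_induct)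
  case (singleton u)
  then show ?case using assms(4) by (auto simp: irrefl_def)
next
  case (insert u D)
  then obtain m where m: "m \<in> D" "\<forall>v\<in>D. (m, v) \<notin> r" by auto
  show ?case
  proof (cases "(m, u) \<in> r")
    case True
    then have "\<forall>v\<in>insert u D. (u, v) \<notin> r"
      using m assms(3,4) by (auto simp: irrefl_def dest: transD)
    then show ?thesis by blast
  next
    case False
    then show ?thesis using m by blast
  qed
qed

lemma strong_ordering_representation:
  fixes G :: "'a pair_pre_digraph" and P :: "'a \<Rightarrow> 'a \<Rightarrow> bool"
  assumes "pair_graph G" and strong: "strong_ordering t G r" and P: "\<And>u v. P u v = P v u"
  shows "\<exists>x. (\<forall>u. x u \<subseteq> {..<t}) \<and>
     (\<forall>(u, v) \<in> parcs G. odd (card (x u \<inter> x v)) \<longleftrightarrow> P u v)"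
proof -
  interpret pair_graph G by fact
  have "sym (parcs G)"
    using pair_sym_arcs by (simp add: symmetric_def)
  then have nbrs_sym: "v \<in> nbrs G u \<longleftrightarrow> u \<in> nbrs G v" for u v
    unfolding nbrs_def sym_def by blast
  have nbrs_verts: "nbrs G u \<subseteq> pverts G" for u
    by (auto simp: nbrs_def dest: in_arcsD2)
  have nbrs_irrefl: "u \<notin> nbrs G u" for u
    using pair_no_loops[of "(u, u)"] by (auto simp: nbrs_def)
  have tr: "trans r" and irr: "irrefl r" and tot: "total_on (pverts G) r"
    using strong by (auto simp: strong_ordering_def strict_linear_order_on_def)
  \<comment> \<open>\<open>D\<close> is an initial segment of the ordering: the vertices treated so
    far. The last clause, applied to the next vertex, makes its equations independent.\<close>
  have "\<exists>x. (\<forall>u. x u \<subseteq> {..<t}) \<and>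
      (\<forall>u\<in>D. \<forall>v\<in>D \<inter> nbrs G u. odd (card (x u \<inter> x v)) \<longleftrightarrow> P u v) \<and>
      (\<forall>v\<in>pverts G - D. xor_indep x (nbrs G v \<inter> D))"
    if "finite D" "D \<subseteq> pverts G" "\<forall>v\<in>D. \<forall>w\<in>pverts G. (w, v) \<in> r \<longrightarrow> w \<in> D" for D
    using that
  proof (induction D rule: finite_psubset_induct)
    case (psubset D)
    show ?case
    proof (cases "D = {}")
      case True
      then show ?thesis by (intro exI[of _ "\<lambda>_. {}"]) (auto simp: xor_indep_def)
    next
      case False
      then obtain u where u: "u \<in> D" "\<forall>v\<in>D. (u, v) \<notin> r"
        using finite_strict_order_maximal[OF psubset.hyps(1) _ tr irr] by blast
      have uV: "u \<in> pverts G" using u psubset.prems by auto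
      define D' where "D' = D - {u}"
      have fin: "finite D'" using psubset.hyps by (simp add: D'_def)
      have D: "D = insert u D'" "u \<notin> D'" using u by (auto simp: D'_def)
      have "\<forall>v\<in>D'. \<forall>w\<in>pverts G. (w, v) \<in> r \<longrightarrow> w \<in> D'"
        using psubset.prems u unfolding D'_def by blast
      moreover have "D' \<subset> D" "D' \<subseteq> pverts G" using D psubset.prems by auto
      ultimately obtain x where x: "\<forall>u. x u \<subseteq> {..<t}"
          "\<forall>u\<in>D'. \<forall>v\<in>D' \<inter> nbrs G u. odd (card (x u \<inter> x v)) \<longleftrightarrow> P u v"
          "\<forall>v\<in>pverts G - D'. xor_indep x (nbrs G v \<inter> D')"
        using psubset.IH[of D'] by blast
      \<comment> \<open>As \<open>u\<close> is the last vertex of \<open>D\<close>, the set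
        \<open>D'\<close> consists of all its predecessors; this turns
        \<open>nbrs_less G r u v\<close> into \<open>nbrs G v \<inter> D'\<close>.\<close>
      have below: "w \<in> D' \<longleftrightarrow> (w, u) \<in> r" if "w \<in> pverts G" for w
      proof
        assume "w \<in> D'"
        then have "w \<noteq> u" "(u, w) \<notin> r" using u D by auto
        then show "(w, u) \<in> r" using tot that uV by (auto simp: total_on_def)
      next
        assume "(w, u) \<in> r"
        then show "w \<in> D'" using psubset.prems u that irr by (auto simp: D'_def irrefl_def)
      qed
      then have less: "nbrs_less G r u v = nbrs G v \<inter> D'" for v
        using nbrs_verts by (auto simp: nbrs_less_def)
      have above: "v \<in> nbrs_greater G r u u" if "v \<in> pverts G - D" "v \<in> nbrs G u" for v
      proof -
        have "v \<noteq> u" "(v, u) \<notin> r" using that below D by auto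
        then have "(u, v) \<in> r" using tot that uV by (auto simp: total_on_def)
        then show ?thesis using that by (simp add: nbrs_greater_def)
      qed
      let ?N = "nbrs G u \<inter> D'"
      \<comment> \<open>\<open>?sol\<close> holds the vectors for \<open>u\<close> that respect its
        edges to \<open>D'\<close>; \<open>?sub\<close> indexes the sums to be avoided.\<close>
      let ?sol = "{y. y \<subseteq> {..<t} \<and> (\<forall>w\<in>?N. odd (card (y \<inter> x w)) \<longleftrightarrow> P u w)}"
      let ?sub = "{X. X \<subseteq> pverts G \<and> (\<exists>v \<in> nbrs_greater G r u u. X \<subseteq> nbrs_less G r u v)}"
      have count: "2 ^ card ?N * card ?sol = (2 :: nat) ^ t"
        using card_xor_solutions[of "{..<t}" ?N x "P u"] fin x uV D by auto
      have fsub: "finite ?sub" by (rule finite_subset[of _ "Pow (pverts G)"]) auto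
      have "card ?sub < card ?sol"
      proof (cases "nbrs_greater G r u u = {}")
        case True
        \<comment> \<open>Nothing is to be avoided here, so one solution suffices; it exists because
          the right-hand side of \<open>count\<close> is nonzero.\<close>
        have "card ?sol > 0" using count by (intro gr0I) simp
        with True show ?thesis by simp
      next
        case False
        \<comment> \<open>The empty set keeps the argument of the logarithm positive, as needed to
          cancel \<open>log 2\<close> against \<open>2 powr\<close>.\<close>
        then have "{} \<in> ?sub" by auto
        then have pos: "card ?sub > 0" using fsub by (auto simp: card_gt_0_iff)
        have "real (card ?N) + log 2 (real (card ?sub)) < real t"
          using mp[OF conjunct1[OF bspec[OF conjunct2[OF conjunct2[OF
                strong[unfolded strong_ordering_def]]] uV]] False]
          by (simp only: less)
        then have "2 powr (real (card ?N) + log 2 (real (card ?sub))) < 2 powr real t"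
          by simp
        then have "real (2 ^ card ?N * card ?sub) < real (2 ^ t)"
          using pos by (simp add: powr_add powr_realpow)
        then have "2 ^ card ?N * card ?sub < 2 ^ card ?N * card ?sol"
          unfolding count of_nat_less_iff .
        then show ?thesis by simp
      qed
      then have "card (xor_sum x ` ?sub) < card ?sol"
        using card_image_le[OF fsub, of "xor_sum x"] by linarith
      then have "\<not> ?sol \<subseteq> xor_sum x ` ?sub"
        using fsub card_mono[of "xor_sum x ` ?sub" ?sol] by auto
      then obtain y where y: "y \<in> ?sol" "y \<notin> xor_sum x ` ?sub" by blast
      let ?x = "x(u := y)"
      have "\<forall>v\<in>D. \<forall>w\<in>D \<inter> nbrs G v. odd (card (?x v \<inter> ?x w)) \<longleftrightarrow> P v w"
      proof (intro ballI)
        fix v w assume v: "v \<in> D" and w: "w \<in> D \<inter> nbrs G v"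
        consider "v = u" "w \<in> ?N" | "w = u" "v \<in> ?N" | "v \<in> D'" "w \<in> D' \<inter> nbrs G v"
          using v w D nbrs_sym nbrs_irrefl by blast
        then show "odd (card (?x v \<inter> ?x w)) \<longleftrightarrow> P v w"
        proof cases
          case 1
          then have "w \<noteq> u" using D by auto
          then show ?thesis using 1 y by auto
        next
          case 2
          then have "v \<noteq> u" using D by auto
          then show ?thesis using 2 y P[of u v] by (auto simp: Int_commute)
        next
          case 3
          then have "v \<noteq> u" "w \<noteq> u" using D by auto
          then show ?thesis using 3 x(2) by simp
        qed
      qed
      moreover have "\<forall>v\<in>pverts G - D. xor_indep ?x (nbrs G v \<inter> D)"
        unfolding xor_indep_def
      proof (intro ballI allI impI)
        fix v S assume v: "v \<in> pverts G - D" and S: "S \<subseteq> nbrs G v \<inter> D" "S \<noteq> {}"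
        show "xor_sum ?x S \<noteq> {}"
        proof (cases "u \<in> S")
          case True
          \<comment> \<open>A vanishing sum over \<open>S\<close> would make \<open>y\<close> the
            sum over \<open>S - {u}\<close>, a set in \<open>?sub\<close> because \<open>v\<close>
            is a later neighbour of \<open>u\<close>.\<close>
          then have "v \<in> nbrs G u" using S nbrs_sym by blast
          then have "S - {u} \<in> ?sub"
            using above[OF v] S psubset.prems unfolding less D'_def by blast
          then have "y \<noteq> xor_sum x (S - {u})" using y by blast
          moreover have "xor_sum ?x (S - {u}) = xor_sum x (S - {u})"
            by (rule xor_sum_cong) auto
          moreover have "finite S" using S psubset.hyps(1) by (auto intro: finite_subset)
          ultimately show ?thesis
            using xor_sum_remove[of S u _ ?x] True by auto
        next
          case False
          then have "xor_sum ?x S = xor_sum x S"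
            by (intro xor_sum_cong) auto
          moreover have "S \<subseteq> nbrs G v \<inter> D'" using S False D by auto
          moreover have "xor_indep x (nbrs G v \<inter> D')" using x(3) v D by auto
          ultimately show ?thesis using S(2) by (simp add: xor_indep_def)
        qed
      qed
      moreover have "\<forall>v. ?x v \<subseteq> {..<t}" using x(1) y by auto
      ultimately show ?thesis by blast
    qed
  qed
  from this[of "pverts G"] obtain x where "\<forall>u. x u \<subseteq> {..<t}"
      "\<forall>u\<in>pverts G. \<forall>v\<in>pverts G \<inter> nbrs G u. odd (card (x u \<inter> x v)) \<longleftrightarrow> P u v"
    by auto
  moreover have "u \<in> pverts G \<and> v \<in> pverts G \<inter> nbrs G u" if "(u, v) \<in> parcs G" for u v
    using that by (auto simp: nbrs_def dest: in_arcsD1 in_arcsD2)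
  ultimately show ?thesis by blast
qed

section \<open>From vectors to walks in the inversion graph\<close>

lemma inversion_iff:
  assumes "orientation G A" "(u, v) \<in> parcs G"
  shows "(u, v) \<in> inversion X A \<longleftrightarrow> ((u, v) \<in> A \<longleftrightarrow> \<not> (u \<in> X \<and> v \<in> X))"
proof -
  have "(u, v) \<in> A \<longleftrightarrow> (v, u) \<notin> A"
    using assms unfolding orientation_def by blast
  then show ?thesis
    by (auto simp: inversion_def)
qed

lemma orientation_eqI:
  assumes "orientation G A" "orientation G B"
    and "\<And>u v. (u, v) \<in> parcs G \<Longrightarrow> (u, v) \<in> A \<longleftrightarrow> (u, v) \<in> B"
  shows "A = B"
  using assms unfolding orientation_def by (intro set_eqI) (auto dest: subsetD)

text \<open>Each coordinate below \<open>k\<close> stands for one inversion. Performing one of them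
  changes the starting orientation and leaves shorter vectors, so the induction generalises both
  \<open>A\<close> and \<open>x\<close>.\<close>

lemma inversion_walk:
  assumes "pair_graph G" "orientation G A" "\<And>u. x u \<subseteq> {..<k}"
    and "orientation G B"
    and "\<And>u v. (u, v) \<in> parcs G \<Longrightarrow> odd (card (x u \<inter> x v)) \<longleftrightarrow> ((u, v) \<in> A \<longleftrightarrow> (u, v) \<notin> B)"
  shows "\<exists>p. pre_digraph.awalk (with_proj (inversion_graph G)) A p B \<and> length p \<le> k"
  using assms(2-5)
proof (induction k arbitrary: A x)
  case 0
  interpret I: pair_graph "inversion_graph G"
    by (rule pair_graph_inversion_graph) fact
  from 0 have "A = B" by (intro orientation_eqI[of G]) auto
  moreover have "A \<in> pverts (inversion_graph G)"
    using 0 by (simp add: inversion_graph_def)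
  ultimately show ?case
    by (intro exI[of _ "[]"]) (simp add: I.awalk_Nil_iff)
next
  case (Suc k)
  interpret G: pair_graph G by fact
  interpret I: pair_graph "inversion_graph G"
    by (rule pair_graph_inversion_graph) fact
  \<comment> \<open>The top coordinate is inverted first; the remaining ones form
    \<open>x'\<close>.\<close>
  define X where "X = {v \<in> pverts G. k \<in> x v}"
  define A' where "A' = inversion X A"
  define x' where "x' u = x u - {k}" for u
  have A': "orientation G A'"
    unfolding A'_def using assms(1) Suc.prems(1) by (rule orientation_inversion)
  \<comment> \<open>Dropping \<open>k\<close> changes the parity exactly when both ends lie in
    \<open>X\<close>, that is, when the inversion of \<open>X\<close> reverses the edge.\<close>
  have "odd (card (x' u \<inter> x' v)) \<longleftrightarrow> ((u, v) \<in> A' \<longleftrightarrow> (u, v) \<notin> B)" if "(u, v) \<in> parcs G" for u v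
  proof -
    have "finite (x' u \<inter> x' v)"
      using Suc.prems(2)[of u] by (auto simp: x'_def intro: finite_subset)
    moreover have "x u \<inter> x v = (if k \<in> x u \<and> k \<in> x v then insert k (x' u \<inter> x' v) else x' u \<inter> x' v)"
      by (auto simp: x'_def)
    moreover have "k \<notin> x' u" by (simp add: x'_def)
    moreover have "u \<in> pverts G" "v \<in> pverts G"
      using that by (auto dest: G.in_arcsD1 G.in_arcsD2)
    ultimately show ?thesis
      using Suc.prems(4)[OF that] inversion_iff[OF Suc.prems(1) that, of X]
      by (auto simp: A'_def X_def split: if_splits)
  qed
  moreover have "x' u \<subseteq> {..<k}" for u
    using Suc.prems(2)[of u] by (auto simp: x'_def less_Suc_eq)
  ultimately obtain p where p: "I.awalk A' p B" "length p \<le> k"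
    using Suc.IH[OF A' _ Suc.prems(3)] by metis
  show ?case
  proof (cases "A = A'")
    case True
    \<comment> \<open>Inverting \<open>X\<close> reversed no arc. The inversion graph has no loops,
      so this inversion is skipped.\<close>
    then show ?thesis using p by auto
  next
    case False
    have "X \<subseteq> pverts G"
      by (auto simp: X_def)
    then have "(A, A') \<in> parcs (inversion_graph G)"
      using Suc.prems(1) A' False \<open>X \<subseteq> pverts G\<close>
      unfolding inversion_graph_def A'_def by auto
    moreover have "A \<in> pverts (inversion_graph G)"
      using Suc.prems(1) by (simp add: inversion_graph_def)
    ultimately have "I.awalk A ((A, A') # p) B"
      using p(1) by (simp add: I.awalk_Cons_iff)
    then show ?thesis using p(2) by (intro exI[of _ "(A, A') # p"]) simp
  qed
qed

theorem theorem3p3: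
  fixes G :: "'a pair_pre_digraph" and t :: nat
  assumes "pair_graph G"
    and "0 < t"
    and "strongly_degenerate t G"
  shows "diameter (with_proj (inversion_graph G)) \<le> ereal (real t)"
proof -
  interpret G: pair_graph G by fact
  interpret I: pair_graph "inversion_graph G"
    by (rule pair_graph_inversion_graph) fact
  have "I.\<mu> (\<lambda>_. 1) A B \<le> ereal (real t)" if AB: "orientation G A" "orientation G B" for A B
  proof -
    define P where "P u v \<longleftrightarrow> (u, v) \<in> parcs G \<and> ((u, v) \<in> A \<longleftrightarrow> (u, v) \<notin> B)" for u v
    have "sym (parcs G)"
      using G.pair_sym_arcs by (simp add: symmetric_def)
    then have sym: "(v, u) \<in> parcs G" if "(u, v) \<in> parcs G" for u v
      using that by (rule symD)
    have flip: "(u, v) \<in> C \<longleftrightarrow> (v, u) \<notin> C" if "orientation G C" "(u, v) \<in> parcs G" for C u v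
      using that unfolding orientation_def by blast
    \<comment> \<open>Passing to the opposite arc negates membership in both \<open>A\<close> and
      \<open>B\<close>, so their disagreement is symmetric.\<close>
    have "P u v = P v u" for u v
      using sym flip[OF AB(1)] flip[OF AB(2)] unfolding P_def by blast
    then obtain x where x: "\<forall>u. x u \<subseteq> {..<t}"
        "\<forall>(u, v) \<in> parcs G. odd (card (x u \<inter> x v)) \<longleftrightarrow> P u v"
      using strong_ordering_representation[OF assms(1), of t _ P] assms(3)
      unfolding strongly_degenerate_def by blast
    have "\<exists>p. I.awalk A p B \<and> length p \<le> t"
      using x by (intro inversion_walk[OF assms(1) AB(1) _ AB(2), of x]) (auto simp: P_def)
    then obtain p where p: "I.awalk A p B" "length p \<le> t" by blast
    have "I.awalk_cost (\<lambda>_. 1) p = real (length p)"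
      by (induction p) auto
    then show ?thesis
      using I.min_cost_le_walk_cost[OF p(1), of "\<lambda>_. 1"] p(2)
      by (metis ereal_less_eq(3) of_nat_le_iff order_trans)
  qed
  then show ?thesis
    unfolding diameter_def by (intro SUP_least) (auto simp: inversion_graph_def)
qed

end
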